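(* In three dimensions, the family $\{A^4_\varepsilon\}_{\varepsilon>0}$ of $4$-averages over the vertex set $J$ of the icosahedron, scaled by $\varepsilon$, has the asymptotic mean value property for the $4$-Laplacian. That is: there is a constant $c$ such that for every bounded domain $\Omega\subset\mathbb{R}^3$, with $\Omega_E=\{x\in\mathbb{R}^3:\operatorname{dist}(x,\Omega)<1\}$, and every $\phi\in C_b^\infty(\Omega_E)$ with $\nabla\phi\neq0$ everywhere on $\Omega_E$, $$\phi(x)=A^4_\varepsilon[\phi](x)+c\,\varepsilon^2\left(-\Delta_4^G\phi(x)\right)+o(\varepsilon^2)\quad\text{as }\varepsilon\to0^+,$$ uniformly for $x\in\Omega$.
   Context: $C_b^\infty(\Omega_E)$ denotes the smooth functions on $\Omega_E$ which are bounded together with all their derivatives. The vertex set of the icosahedron is the set of 12 vectors $J=\{(0,\pm1,\pm\tau),(\pm1,\pm\tau,0),(\pm\tau,0,\pm1)\}\subset\mathbb{R}^3$ (all sign choices), where $\tau=\frac{1+\sqrt5}{2}$. For $x\in\Omega$ and $\varepsilon>0$ small enough that $x+\varepsilon\eta\in\Omega_E$ for all $\eta\in J$, $A^4_\varepsilon[\phi](x)$ is the unique minimizer over $\lambda\in\mathbb{R}$ of $\sum_{\eta\in J}|\phi(x+\varepsilon\eta)-\lambda|^4$. The game (normalized) $p$-Laplacian of a smooth function $u$ at points where $\nabla u\ne0$ is $$\Delta_p^Gu=\frac1p|\nabla u|^{2-p}\operatorname{div}(|\nabla u|^{p-2}\nabla u)=\frac1p\Delta u+\frac{p-2}{p}|\nabla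 u|^{-2}\sum_{i,j}\frac{\partial u}{\partial x_i}\frac{\partial u}{\partial x_j}\frac{\partial^2u}{\partial x_i\partial x_j}.$$ *)

theory Defs
  imports "HOL-Analysis.Analysis"
begin

text \<open>Differential operators on functions that are defined on all of
  \<open>real ^ 'n\<close>; their values at a point of an open set depend only on the
  function near that point.\<close>

definition partial_deriv :: "'n::finite \<Rightarrow> (real ^ 'n \<Rightarrow> real) \<Rightarrow> real ^ 'n \<Rightarrow> real" where
  "partial_deriv i f x = frechet_derivative f (at x) (axis i 1)"

primrec iterated_partial :: "'n::finite list \<Rightarrow> (real ^ 'n \<Rightarrow> real) \<Rightarrow> real ^ 'n \<Rightarrow> real" where
  "iterated_partial [] f = f"
| "iterated_partial (i # is) f = partial_deriv i (iterated_partial is f)"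

text \<open>Smooth functions on an open set \<open>U\<close>, bounded together with all their derivatives.
  Differentiability of the iterated partial derivatives of every order gives their continuity,
  hence smoothness.\<close>

definition Cb_infinity :: "(real ^ 'n::finite) set \<Rightarrow> (real ^ 'n \<Rightarrow> real) set" where
  "Cb_infinity U = {f. \<forall>is. (\<forall>x\<in>U. iterated_partial is f differentiable (at x)) \<and>
                            bounded (iterated_partial is f ` U)}"

definition grad :: "(real ^ 'n::finite \<Rightarrow> real) \<Rightarrow> real ^ 'n \<Rightarrow> real ^ 'n" where
  "grad f x = (\<chi> i. partial_deriv i f x)"

definition divergence :: "(real ^ 'n::finite \<Rightarrow> real ^ 'n) \<Rightarrow> real ^ 'n \<Rightarrow> real" where
  "divergence F x = (\<Sum>i\<in>UNIV. partial_deriv i (\<lambda>y. F y $ i) x)"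

text \<open>The game (normalized) \<open>p\<close>-Laplacian, meaningful where \<open>grad u x \<noteq> 0\<close>.\<close>

definition game_p_laplacian :: "real \<Rightarrow> (real ^ 'n::finite \<Rightarrow> real) \<Rightarrow> real ^ 'n \<Rightarrow> real" where
  "game_p_laplacian p u x =
     1 / p * norm (grad u x) powr (2 - p) *
     divergence (\<lambda>y. norm (grad u y) powr (p - 2) *\<^sub>R grad u y) x"

definition golden_ratio :: real where
  "golden_ratio = (1 + sqrt 5) / 2"

definition icosahedron :: "(real ^ 3) set" where
  "icosahedron =
     {vector [0, a, b * golden_ratio] | a b. a \<in> {1, -1} \<and> b \<in> {1, -1}} \<union>
     {vector [a, b * golden_ratio, 0] | a b. a \<in> {1, -1} \<and> b \<in> {1, -1}} \<union>
     {vector [a * golden_ratio, 0, b] | a b. a \<in> {1, -1} \<and> b \<in> {1, -1}}"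

definition four_average :: "real \<Rightarrow> (real ^ 3 \<Rightarrow> real) \<Rightarrow> real ^ 3 \<Rightarrow> real" where
  "four_average \<epsilon> \<phi> x =
     (THE l. is_arg_min (\<lambda>l. \<Sum>\<eta>\<in>icosahedron. \<bar>\<phi> (x + \<epsilon> *\<^sub>R \<eta>) - l\<bar> ^ 4) (\<lambda>_. True) l)"

definition unit_enlargement :: "'a::metric_space set \<Rightarrow> 'a set" where
  "unit_enlargement \<Omega> = {x. infdist x \<Omega> < 1}"

end

theory Submission
  imports Defs
begin

text \<open>The minimiser \<open>l\<close> of \<open>\<Sum>\<eta>. \<bar>\<phi> (x + \<epsilon> \<eta>) - l\<bar> ^ 4\<close> is the zero of \<open>\<Sum>\<eta>. (\<phi> (x + \<epsilon> \<eta>) - l) ^ 3\<close>.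
  Put \<open>p = grad \<phi> x\<close>, let \<open>H\<close> be the matrix of second derivatives at \<open>x\<close>, and write
  \<open>v = p \<bullet> \<eta>\<close> and \<open>w = (\<eta> \<bullet> H \<eta>) / 2\<close> for the first two Taylor coefficients in the direction \<open>\<eta>\<close>.
  For \<open>l = \<phi> x + \<epsilon>\<^sup>2 m\<close> the cubic sum becomes
  \<open>\<epsilon>\<^sup>3 \<Sum>v\<^sup>3 + 3 \<epsilon>\<^sup>4 \<Sum>v\<^sup>2 (w - m) + O(\<epsilon>\<^sup>5)\<close>. The first term vanishes because the
  icosahedron is symmetric under \<open>\<eta> \<mapsto> - \<eta>\<close>, so to leading order \<open>m\<close> is the mean of \<open>w\<close>
  with weights \<open>v\<^sup>2\<close>. As the cubic sum changes sign between \<open>m - \<kappa>\<close> and \<open>m + \<kappa>\<close> once \<open>\<epsilon>\<close> is small,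
  its zero is caught within \<open>\<kappa> \<epsilon>\<^sup>2\<close> of \<open>\<phi> x + \<epsilon>\<^sup>2 m\<close> (\<open>quartic_mean_expansion\<close>).

  The icosahedron enters through its moments of degree two and four, which are isotropic, that is,
  proportional to the corresponding moments of a sphere. Hence \<open>\<Sum>v\<^sup>2\<close> is a multiple of
  \<open>(norm p)\<^sup>2\<close> and \<open>\<Sum>v\<^sup>2 w\<close> is a multiple of \<open>(norm p)\<^sup>2 tr H + 2 (p \<bullet> H p)\<close>. Their quotient is
  a constant times \<open>tr H + 2 (p \<bullet> H p) / (norm p)\<^sup>2\<close>, which is four times the game 4-Laplacian
  (\<open>game_4_laplacian_eq\<close>); the weight 2 on the second term, which comes from the fourth moments,
  is exactly the factor \<open>4 - 2\<close> of the game 4-Laplacian.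

  Uniformity in \<open>x\<close> holds because \<open>\<epsilon>\<close> has to be small only in terms of a bound on the derivatives
  up to order three and of a positive lower bound for the gradient; the latter exists by compactness
  of the closure of the domain, which lies inside the unit enlargement.\<close>

section \<open>Means of fourth order\<close>

text \<open>A convexity argument in algebraic form: with \<open>b = a j - l\<close>,
  \<open>(b - d) ^ 4 - b ^ 4 = - 4 d b\<^sup>3 + d\<^sup>2 (2 b\<^sup>2 + (2 b - d)\<^sup>2)\<close>. The first term cancels in the sum, and
  the second is positive for \<open>d \<noteq> 0\<close>, which gives minimality and uniqueness at once.\<close>

lemma quartic_mean_eqI:
  fixes a :: "'i \<Rightarrow> real"
  assumes J: "finite J" "J \<noteq> {}" and zero: "(\<Sum>j\<in>J. (a j - l) ^ 3) = 0"
  shows "(THE l. is_arg_min (\<lambda>l. \<Sum>j\<in>J. \<bar>a j - l\<bar> ^ 4) (\<lambda>_. True) l) = l"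
proof -
  define F where "F = (\<lambda>l. \<Sum>j\<in>J. \<bar>a j - l\<bar> ^ 4)"
  have less: "F l < F k" if "k \<noteq> l" for k
  proof -
    define d where "d = k - l"
    have "d \<noteq> 0" using that by (simp add: d_def)
    have "0 < (\<Sum>j\<in>J. d\<^sup>2 * (2 * (a j - l)\<^sup>2 + (2 * (a j - l) - d)\<^sup>2))"
    proof (rule sum_pos[OF J])
      fix j
      have "2 * (a j - l)\<^sup>2 + (2 * (a j - l) - d)\<^sup>2 > 0"
      proof (cases "a j - l = 0")
        case True
        then show ?thesis using \<open>d \<noteq> 0\<close> by simp
      next
        case False
        then have "(a j - l)\<^sup>2 > 0" by simp
        then show ?thesis by (smt (verit) zero_le_power2)
      qed
      then show "0 < d\<^sup>2 * (2 * (a j - l)\<^sup>2 + (2 * (a j - l) - d)\<^sup>2)"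
        using \<open>d \<noteq> 0\<close> by simp
    qed
    also have "\<dots> = (\<Sum>j\<in>J. (a j - k) ^ 4 - (a j - l) ^ 4 + 4 * d * (a j - l) ^ 3)"
      by (rule sum.cong) (auto simp: d_def power2_eq_square power3_eq_cube power4_eq_xxxx algebra_simps)
    also have "\<dots> = F k - F l + 4 * d * (\<Sum>j\<in>J. (a j - l) ^ 3)"
      by (simp add: F_def sum.distrib sum_subtractf sum_distrib_left)
    finally show ?thesis by (simp add: zero)
  qed
  have "is_arg_min F (\<lambda>_. True) k \<longleftrightarrow> k = l" for k
    using less by (metis is_arg_min_def less_asym)
  then show ?thesis by (simp add: F_def)
qed

text \<open>The cubic sum at \<open>a0 + \<epsilon>\<^sup>2 (m + s)\<close> is \<open>- 3 \<epsilon>\<^sup>4 s \<Sum>v\<^sup>2\<close> up to an error of order \<open>\<epsilon>\<^sup>5\<close>, because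
  \<open>odd\<close> removes the term of order \<open>\<epsilon>\<^sup>3\<close> and the choice of \<open>m\<close> removes the rest of the term of
  order \<open>\<epsilon>\<^sup>4\<close>. So the sum has opposite signs at \<open>s = \<kappa>\<close> and \<open>s = - \<kappa>\<close>, and the intermediate value
  theorem yields a zero in between. The smallness condition on \<open>\<epsilon>\<close> involves the data only through
  \<open>B\<close>, \<open>q\<close> and the number of points, which is what makes the estimate uniform.\<close>

lemma quartic_mean_expansion:
  fixes J :: "'i set" and a v w r :: "'i \<Rightarrow> real" and a0 B q \<kappa> \<epsilon> :: real
  defines "m \<equiv> (\<Sum>j\<in>J. (v j)\<^sup>2 * w j) / (\<Sum>j\<in>J. (v j)\<^sup>2)"
  assumes J: "finite J"
    and odd: "(\<Sum>j\<in>J. v j ^ 3) = 0"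
    and q: "0 < q" "q \<le> (\<Sum>j\<in>J. (v j)\<^sup>2)"
    and B: "1 \<le> B" "\<And>j. j \<in> J \<Longrightarrow> \<bar>v j\<bar> \<le> B" "\<And>j. j \<in> J \<Longrightarrow> \<bar>w j\<bar> \<le> B"
           "\<And>j. j \<in> J \<Longrightarrow> \<bar>r j\<bar> \<le> B"
    and \<kappa>: "0 < \<kappa>" "\<kappa> \<le> 1"
    and \<epsilon>: "0 < \<epsilon>" "\<epsilon> \<le> 1" "115 * real (card J) * B ^ 3 * \<epsilon> < 3 * \<kappa> * q"
    and a: "\<And>j. j \<in> J \<Longrightarrow> a j = a0 + \<epsilon> * v j + \<epsilon>\<^sup>2 * w j + \<epsilon> ^ 3 * r j"
  shows "\<bar>(THE l. is_arg_min (\<lambda>l. \<Sum>j\<in>J. \<bar>a j - l\<bar> ^ 4) (\<lambda>_. True) l) - (a0 + \<epsilon>\<^sup>2 * m)\<bar> \<le> \<kappa> * \<epsilon>\<^sup>2"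
proof -
  define Q where "Q = (\<Sum>j\<in>J. (v j)\<^sup>2)"
  have Q: "q \<le> Q" "0 < Q" using q by (auto simp: Q_def)
  have mQ: "m * Q = (\<Sum>j\<in>J. (v j)\<^sup>2 * w j)"
    using Q by (simp add: m_def Q_def)
  have "\<bar>m\<bar> * Q = \<bar>\<Sum>j\<in>J. (v j)\<^sup>2 * w j\<bar>"
    using Q by (simp add: abs_mult flip: mQ)
  also have "\<dots> \<le> (\<Sum>j\<in>J. (v j)\<^sup>2 * B)"
    by (rule order.trans[OF sum_abs sum_mono]) (auto simp: abs_mult intro!: mult_left_mono B)
  also have "\<dots> = B * Q" by (simp add: Q_def mult.commute[of _ B] sum_distrib_left)
  finally have m: "\<bar>m\<bar> \<le> B" using Q by simp
  define S where "S = (\<lambda>l. \<Sum>j\<in>J. (a j - l) ^ 3)"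
  have S: "\<bar>S (a0 + \<epsilon>\<^sup>2 * (m + s)) + 3 * \<epsilon> ^ 4 * s * Q\<bar> < \<epsilon> ^ 4 * (3 * \<kappa> * q)" if s: "\<bar>s\<bar> \<le> 1" for s
  proof -
    define u where "u = (\<lambda>j. w j - m - s + \<epsilon> * r j)"
    \<comment> \<open>The deviation from the trial value is \<open>\<epsilon> (v j + \<epsilon> u j)\<close>, and \<open>E j\<close> collects all
      contributions of order \<open>\<epsilon>\<^sup>5\<close> to its cube; \<open>115 = 3 + 3 \<cdot> 16 + 64\<close> below.\<close>
    have u: "\<bar>u j\<bar> \<le> 4 * B" if "j \<in> J" for j
    proof -
      have "\<bar>\<epsilon> * r j\<bar> \<le> 1 * B"
        unfolding abs_mult using \<epsilon> B(4)[OF that] by (intro mult_mono) auto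
      then show ?thesis
        using s m B(1) B(3)[OF that] unfolding u_def by linarith
    qed
    define E where "E = (\<lambda>j. 3 * (v j)\<^sup>2 * r j + 3 * v j * (u j)\<^sup>2 + \<epsilon> * u j ^ 3)"
    have E: "\<bar>E j\<bar> \<le> 115 * B ^ 3" if "j \<in> J" for j
    proof -
      have 1: "\<bar>(v j)\<^sup>2 * r j\<bar> \<le> B\<^sup>2 * B"
        unfolding abs_mult power_abs using B(2,4)[OF that] by (intro mult_mono power_mono) auto
      have 2: "\<bar>v j * (u j)\<^sup>2\<bar> \<le> B * (4 * B)\<^sup>2"
        unfolding abs_mult power_abs using B(1) B(2)[OF that] u[OF that] by (intro mult_mono power_mono) auto
      have 3: "\<bar>\<epsilon> * u j ^ 3\<bar> \<le> 1 * (4 * B) ^ 3"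
        unfolding abs_mult power_abs using \<epsilon> B(1) u[OF that] by (intro mult_mono power_mono) auto
      have "\<bar>E j\<bar> \<le> 3 * \<bar>(v j)\<^sup>2 * r j\<bar> + 3 * \<bar>v j * (u j)\<^sup>2\<bar> + \<bar>\<epsilon> * u j ^ 3\<bar>"
        unfolding E_def by linarith
      also have "\<dots> \<le> 3 * (B\<^sup>2 * B) + 3 * (B * (4 * B)\<^sup>2) + 1 * (4 * B) ^ 3"
        using 1 2 3 by linarith
      also have "\<dots> = 115 * B ^ 3" by (simp add: power2_eq_square power3_eq_cube)
      finally show ?thesis .
    qed
    have "S (a0 + \<epsilon>\<^sup>2 * (m + s)) =
        (\<Sum>j\<in>J. \<epsilon> ^ 3 * v j ^ 3 + 3 * \<epsilon> ^ 4 * ((v j)\<^sup>2 * w j) - 3 * \<epsilon> ^ 4 * (m + s) * (v j)\<^sup>2 + \<epsilon> ^ 5 * E j)"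
      unfolding S_def
    proof (rule sum.cong)
      fix j assume "j \<in> J"
      have "a j - (a0 + \<epsilon>\<^sup>2 * (m + s)) = \<epsilon> * (v j + \<epsilon> * u j)"
        unfolding a[OF \<open>j \<in> J\<close>] u_def by (simp add: power2_eq_square power3_eq_cube algebra_simps)
      moreover have "(\<epsilon> * (v j + \<epsilon> * u j)) ^ 3 =
          \<epsilon> ^ 3 * v j ^ 3 + 3 * \<epsilon> ^ 4 * (v j)\<^sup>2 * u j + \<epsilon> ^ 5 * (3 * v j * (u j)\<^sup>2 + \<epsilon> * u j ^ 3)"
        by algebra
      moreover have "3 * \<epsilon> ^ 4 * (v j)\<^sup>2 * u j =
          3 * \<epsilon> ^ 4 * ((v j)\<^sup>2 * w j) - 3 * \<epsilon> ^ 4 * (m + s) * (v j)\<^sup>2 + \<epsilon> ^ 5 * (3 * (v j)\<^sup>2 * r j)"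
        unfolding u_def by algebra
      ultimately show "(a j - (a0 + \<epsilon>\<^sup>2 * (m + s))) ^ 3 =
          \<epsilon> ^ 3 * v j ^ 3 + 3 * \<epsilon> ^ 4 * ((v j)\<^sup>2 * w j) - 3 * \<epsilon> ^ 4 * (m + s) * (v j)\<^sup>2 + \<epsilon> ^ 5 * E j"
        unfolding E_def by (simp add: algebra_simps)
    qed simp
    also have "\<dots> = \<epsilon> ^ 3 * (\<Sum>j\<in>J. v j ^ 3) + 3 * \<epsilon> ^ 4 * (\<Sum>j\<in>J. (v j)\<^sup>2 * w j)
                 - 3 * \<epsilon> ^ 4 * (m + s) * Q + \<epsilon> ^ 5 * (\<Sum>j\<in>J. E j)"
      by (simp add: Q_def sum.distrib sum_subtractf sum_distrib_left)
    also have "\<dots> = - 3 * \<epsilon> ^ 4 * s * Q + \<epsilon> ^ 5 * (\<Sum>j\<in>J. E j)"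
      unfolding odd mQ[symmetric] by (simp add: algebra_simps)
    finally have "\<bar>S (a0 + \<epsilon>\<^sup>2 * (m + s)) + 3 * \<epsilon> ^ 4 * s * Q\<bar> = \<epsilon> ^ 5 * \<bar>\<Sum>j\<in>J. E j\<bar>"
      using \<epsilon> by (simp add: abs_mult)
    also have "\<dots> \<le> \<epsilon> ^ 5 * (\<Sum>j\<in>J. 115 * B ^ 3)"
      using \<epsilon> by (intro mult_left_mono order.trans[OF sum_abs sum_mono] E) auto
    also have "\<dots> = \<epsilon> ^ 4 * (115 * real (card J) * B ^ 3 * \<epsilon>)" by (simp add: eval_nat_numeral)
    also have "\<dots> < \<epsilon> ^ 4 * (3 * \<kappa> * q)" using \<epsilon> by (intro mult_strict_left_mono) auto
    finally show ?thesis .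
  qed
  have "\<epsilon> ^ 4 * (3 * \<kappa> * q) \<le> 3 * \<epsilon> ^ 4 * \<kappa> * Q"
    using Q \<epsilon> \<kappa> by (simp add: mult_left_mono)
  then have "S (a0 + \<epsilon>\<^sup>2 * (m + \<kappa>)) \<le> 0" "0 \<le> S (a0 + \<epsilon>\<^sup>2 * (m + - \<kappa>))"
    using S[of \<kappa>] S[of "- \<kappa>"] \<kappa> by linarith+
  moreover have "continuous_on X S" for X
    unfolding S_def by (intro continuous_intros)
  moreover have "a0 + \<epsilon>\<^sup>2 * (m + - \<kappa>) \<le> a0 + \<epsilon>\<^sup>2 * (m + \<kappa>)"
    using \<kappa> by (intro add_left_mono mult_left_mono) auto
  ultimately obtain l where l: "a0 + \<epsilon>\<^sup>2 * (m + - \<kappa>) \<le> l" "l \<le> a0 + \<epsilon>\<^sup>2 * (m + \<kappa>)" "S l = 0"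
    using IVT2'[of S "a0 + \<epsilon>\<^sup>2 * (m + \<kappa>)" 0 "a0 + \<epsilon>\<^sup>2 * (m + - \<kappa>)"] by blast
  have "J \<noteq> {}" using Q by (auto simp: Q_def)
  then have "(THE l. is_arg_min (\<lambda>l. \<Sum>j\<in>J. \<bar>a j - l\<bar> ^ 4) (\<lambda>_. True) l) = l"
    using quartic_mean_eqI[OF J _ l(3)[unfolded S_def]] by simp
  then show ?thesis using l by (simp add: abs_le_iff algebra_simps)
qed

section \<open>Taylor expansion along a line\<close>

text \<open>The \<open>k\<close>-th derivative at \<open>x\<close> in the direction \<open>\<eta>\<close>, expanded over all index lists of
  length \<open>k\<close>: the sum runs over ordered indices, so the next derivative merely puts one more index
  in front.\<close>

definition directional_deriv :: "real ^ 'n \<Rightarrow> nat \<Rightarrow> (real ^ 'n::finite \<Rightarrow> real) \<Rightarrow> real ^ 'n \<Rightarrow> real" where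
  "directional_deriv \<eta> k f x =
     (\<Sum>is | length is = k. prod_list (map (($) \<eta>) is) * iterated_partial is f x)"

lemma sum_lists_Suc:
  fixes g :: "'n::finite list \<Rightarrow> real"
  shows "(\<Sum>is | length is = Suc k. g is) = (\<Sum>i\<in>UNIV. \<Sum>is | length is = k. g (i # is))"
proof -
  have "{is :: 'n list. length is = Suc k} = (\<lambda>(i, is). i # is) ` (UNIV \<times> {is. length is = k})"
    by (auto simp: length_Suc_conv image_iff)
  then have "(\<Sum>is | length is = Suc k. g is) = (\<Sum>(i, is)\<in>UNIV \<times> {is. length is = k}. g (i # is))"
    by (simp add: sum.reindex inj_on_def case_prod_unfold o_def)
  then show ?thesis by (simp add: sum.cartesian_product)
qed

lemma directional_deriv_0 [simp]: "directional_deriv \<eta> 0 f x = f x"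
  by (simp add: directional_deriv_def)

lemma directional_deriv_1: "directional_deriv \<eta> (Suc 0) f x = grad f x \<bullet> \<eta>"
  by (simp add: directional_deriv_def sum_lists_Suc inner_vec_def grad_def mult.commute)

lemma directional_deriv_2:
  "directional_deriv \<eta> 2 f x =
     (\<Sum>i\<in>UNIV. \<Sum>j\<in>UNIV. \<eta> $ i * \<eta> $ j * iterated_partial [i, j] f x)"
  by (simp add: directional_deriv_def sum_lists_Suc numeral_2_eq_2)

text \<open>The coefficients of a directional derivative are the terms in the expansion of
  \<open>(\<Sum>i. \<eta> $ i) ^ k\<close>, so their absolute values add up to the \<open>k\<close>-th power of the 1-norm of \<open>\<eta>\<close>.\<close>

lemma abs_directional_deriv_le:
  fixes f :: "real ^ 'n::finite \<Rightarrow> real"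
  assumes "\<And>is. length is = k \<Longrightarrow> \<bar>iterated_partial is f x\<bar> \<le> B"
  shows "\<bar>directional_deriv \<eta> k f x\<bar> \<le> (\<Sum>i\<in>UNIV. \<bar>\<eta> $ i\<bar>) ^ k * B"
proof -
  have "(\<Sum>is | length is = k. \<bar>prod_list (map (($) \<eta>) is)\<bar>) = (\<Sum>i\<in>UNIV. \<bar>\<eta> $ i\<bar>) ^ k"
    by (induction k) (simp_all add: sum_lists_Suc abs_mult flip: sum_distrib_left sum_distrib_right)
  moreover have "\<bar>directional_deriv \<eta> k f x\<bar> \<le> (\<Sum>is | length is = k. \<bar>prod_list (map (($) \<eta>) is)\<bar> * B)"
    unfolding directional_deriv_def using assms
    by (intro order.trans[OF sum_abs sum_mono]) (auto simp: abs_mult intro!: mult_left_mono)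
  ultimately show ?thesis by (simp flip: sum_distrib_right)
qed

lemma partial_deriv_eqI:
  assumes "(f has_derivative f') (at x)"
  shows "partial_deriv i f x = f' (axis i 1)"
  using frechet_derivative_at[OF assms] by (simp add: partial_deriv_def)

lemma has_derivative_along_line:
  fixes f :: "real ^ 'n::finite \<Rightarrow> real"
  assumes "f differentiable at (x + t *\<^sub>R \<eta>)"
  shows "((\<lambda>t. f (x + t *\<^sub>R \<eta>)) has_real_derivative
            (\<Sum>i\<in>UNIV. \<eta> $ i * partial_deriv i f (x + t *\<^sub>R \<eta>))) (at t)"
proof -
  let ?D = "frechet_derivative f (at (x + t *\<^sub>R \<eta>))"
  have D: "(f has_derivative ?D) (at (x + t *\<^sub>R \<eta>))"
    using assms by (simp add: frechet_derivative_works)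
  have "?D \<eta> = ?D (\<Sum>i\<in>UNIV. \<eta> $ i *\<^sub>R axis i 1)"
    using basis_expansion[of \<eta>] by (simp add: scalar_mult_eq_scaleR)
  also have "\<dots> = (\<Sum>i\<in>UNIV. \<eta> $ i * partial_deriv i f (x + t *\<^sub>R \<eta>))"
    using has_derivative_linear[OF D] by (simp add: linear_sum linear_scale partial_deriv_def)
  finally have "?D \<eta> = (\<Sum>i\<in>UNIV. \<eta> $ i * partial_deriv i f (x + t *\<^sub>R \<eta>))" .
  moreover have "((\<lambda>t. f (x + t *\<^sub>R \<eta>)) has_derivative (\<lambda>s. ?D (s *\<^sub>R \<eta>))) (at t)"
    by (rule has_derivative_compose[where g = f and g' = ?D and f = "\<lambda>t. x + t *\<^sub>R \<eta>", OF _ D])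
      (auto intro!: derivative_eq_intros)
  moreover have "(\<lambda>s. ?D (s *\<^sub>R \<eta>)) = (*) (?D \<eta>)"
    using has_derivative_linear[OF D] by (simp add: fun_eq_iff linear_scale mult.commute)
  ultimately show ?thesis
    by (simp add: has_field_derivative_def)
qed

text \<open>Consecutive directional derivatives are consecutive derivatives of the restriction to a line,
  which brings the one-variable Maclaurin formula into play.\<close>

lemma directional_deriv_along_line:
  fixes f :: "real ^ 'n::finite \<Rightarrow> real"
  assumes "\<And>is. length is = k \<Longrightarrow> iterated_partial is f differentiable at (x + t *\<^sub>R \<eta>)"
  shows "((\<lambda>t. directional_deriv \<eta> k f (x + t *\<^sub>R \<eta>)) has_real_derivative
            directional_deriv \<eta> (Suc k) f (x + t *\<^sub>R \<eta>)) (at t)"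
proof -
  have "((\<lambda>t. directional_deriv \<eta> k f (x + t *\<^sub>R \<eta>)) has_real_derivative
     (\<Sum>is | length is = k. prod_list (map (($) \<eta>) is) *
        (\<Sum>i\<in>UNIV. \<eta> $ i * partial_deriv i (iterated_partial is f) (x + t *\<^sub>R \<eta>)))) (at t)"
    unfolding directional_deriv_def
    by (intro DERIV_sum DERIV_cmult has_derivative_along_line assms) simp
  also have "(\<Sum>is | length is = k. prod_list (map (($) \<eta>) is) *
        (\<Sum>i\<in>UNIV. \<eta> $ i * partial_deriv i (iterated_partial is f) (x + t *\<^sub>R \<eta>)))
     = directional_deriv \<eta> (Suc k) f (x + t *\<^sub>R \<eta>)"
    unfolding directional_deriv_def sum_lists_Suc sum_distrib_left
    by (subst sum.swap) (simp add: mult.assoc mult.left_commute)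
  finally show ?thesis .
qed

lemma taylor_along_line:
  fixes f :: "real ^ 'n::finite \<Rightarrow> real"
  assumes "0 < h" "0 < n"
    and "\<And>is t. length is < n \<Longrightarrow> 0 \<le> t \<Longrightarrow> t \<le> h \<Longrightarrow>
           iterated_partial is f differentiable at (x + t *\<^sub>R \<eta>)"
  shows "\<exists>t. 0 < t \<and> t < h \<and> f (x + h *\<^sub>R \<eta>) =
     (\<Sum>k<n. directional_deriv \<eta> k f x / fact k * h ^ k)
       + directional_deriv \<eta> n f (x + t *\<^sub>R \<eta>) / fact n * h ^ n"
  using Maclaurin[OF assms(1,2), of "\<lambda>k t. directional_deriv \<eta> k f (x + t *\<^sub>R \<eta>)"
      "\<lambda>t. f (x + t *\<^sub>R \<eta>)"] directional_deriv_along_line[of _ f x _ \<eta>] assms(3)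
  by (auto simp: fun_eq_iff)

section \<open>The game Laplacian in coordinates\<close>

text \<open>The exponent \<open>4 - 2 = 2\<close> turns the power of the norm into the polynomial \<open>\<Sum>k. (grad u y $ k)\<^sup>2\<close>,
  so the divergence follows from the product rule.\<close>

lemma game_4_laplacian_eq:
  fixes u :: "real ^ 'n::finite \<Rightarrow> real"
  assumes diff: "\<And>i. partial_deriv i u differentiable at x" and nz: "grad u x \<noteq> 0"
  shows "game_p_laplacian 4 u x =
    1 / 4 * ((\<Sum>i\<in>UNIV. iterated_partial [i, i] u x) +
      2 * (\<Sum>i\<in>UNIV. \<Sum>j\<in>UNIV. grad u x $ i * grad u x $ j * iterated_partial [i, j] u x)
        / (norm (grad u x))\<^sup>2)"
proof -
  let ?g = "grad u x"
  define D where "D = (\<lambda>k. frechet_derivative (partial_deriv k u) (at x))"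
  have D: "(partial_deriv k u has_derivative D k) (at x)" for k
    using diff by (simp add: D_def frechet_derivative_works)
  have H: "D k (axis i 1) = iterated_partial [i, k] u x" for i k
    by (simp add: D_def partial_deriv_def)
  have norm_sq: "(norm z)\<^sup>2 = (\<Sum>k\<in>UNIV. (z $ k)\<^sup>2)" for z :: "real ^ 'n"
    by (simp add: norm_vec_def L2_set_def sum_nonneg)
  have powr2: "norm z powr 2 = (\<Sum>k\<in>UNIV. (z $ k)\<^sup>2)" for z :: "real ^ 'n"
    by (simp add: norm_sq powr_numeral)
  have grad_component: "grad u y $ k = partial_deriv k u y" for y k
    by (simp add: grad_def)
  have "((\<lambda>y. (\<Sum>k\<in>UNIV. (partial_deriv k u y)\<^sup>2) * partial_deriv i u y) has_derivative
     (\<lambda>h. (\<Sum>k\<in>UNIV. (?g $ k)\<^sup>2) * D i h + (\<Sum>k\<in>UNIV. 2 * ?g $ k * D k h) * ?g $ i)) (at x)" for i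
    by (auto intro!: derivative_eq_intros D simp: grad_component fun_eq_iff algebra_simps)
  note partial_deriv_eqI[OF this]
  then have "divergence (\<lambda>y. norm (grad u y) powr (4 - 2) *\<^sub>R grad u y) x =
      (\<Sum>i\<in>UNIV. (norm ?g)\<^sup>2 * iterated_partial [i, i] u x
        + (\<Sum>k\<in>UNIV. 2 * ?g $ k * iterated_partial [i, k] u x) * ?g $ i)"
    by (simp add: divergence_def powr2 grad_component H norm_sq del: iterated_partial.simps)
  also have "\<dots> = (norm ?g)\<^sup>2 * (\<Sum>i\<in>UNIV. iterated_partial [i, i] u x) +
      2 * (\<Sum>i\<in>UNIV. \<Sum>j\<in>UNIV. ?g $ i * ?g $ j * iterated_partial [i, j] u x)"
    by (simp add: sum.distrib sum_distrib_left sum_distrib_right mult_ac del: iterated_partial.simps)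
  finally show ?thesis
    using nz by (simp add: game_p_laplacian_def powr_minus field_simps del: iterated_partial.simps)
qed

section \<open>Moments of the icosahedron\<close>

lemma golden_ratio_square: "golden_ratio\<^sup>2 = golden_ratio + 1"
  by (simp add: golden_ratio_def power2_eq_square field_simps)

lemma golden_ratio_bounds: "1 < golden_ratio" "golden_ratio < 2"
proof -
  have "sqrt 5 < 3" "1 < sqrt 5" by (auto intro: real_less_lsqrt)
  then show "1 < golden_ratio" "golden_ratio < 2" by (auto simp: golden_ratio_def)
qed

lemma icosahedron_eq_images:
  "icosahedron =
     (\<lambda>(a, b). vector [0, a, b * golden_ratio]) ` ({1, -1} \<times> {1, -1}) \<union>
     (\<lambda>(a, b). vector [a, b * golden_ratio, 0]) ` ({1, -1} \<times> {1, -1}) \<union>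
     (\<lambda>(a, b). vector [a * golden_ratio, 0, b]) ` ({1, -1} \<times> {1, -1})"
proof -
  have "{f a b | a b. a \<in> S \<and> b \<in> S} = (\<lambda>(a, b). f a b) ` (S \<times> S)"
    for f :: "real \<Rightarrow> real \<Rightarrow> real ^ 3" and S by auto
  then show ?thesis unfolding icosahedron_def by (simp only:)
qed

lemma finite_icosahedron: "finite icosahedron"
  by (simp add: icosahedron_eq_images)

text \<open>The twelve vertices are pairwise distinct, so a sum over the set is a sum over the three
  cyclic patterns and the four choices of signs.\<close>

lemma sum_icosahedron:
  fixes f :: "real ^ 3 \<Rightarrow> real"
  shows "sum f icosahedron = (\<Sum>a\<in>{1, -1}. \<Sum>b\<in>{1, -1}.
     f (vector [0, a, b * golden_ratio]) + f (vector [a, b * golden_ratio, 0])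
       + f (vector [a * golden_ratio, 0, b]))"
proof -
  define s where "s = {1, -1 :: real}"
  have s: "finite s" "\<And>a. a \<in> s \<Longrightarrow> a \<noteq> 0" by (auto simp: s_def)
  let ?A = "(\<lambda>(a, b). vector [0, a, b * golden_ratio] :: real ^ 3)"
  let ?B = "(\<lambda>(a, b). vector [a, b * golden_ratio, 0] :: real ^ 3)"
  let ?C = "(\<lambda>(a, b). vector [a * golden_ratio, 0, b] :: real ^ 3)"
  have nz: "golden_ratio \<noteq> 0" using golden_ratio_bounds by simp
  have "?A ` (s \<times> s) \<inter> ?B ` (s \<times> s) = {}" "(?A ` (s \<times> s) \<union> ?B ` (s \<times> s)) \<inter> ?C ` (s \<times> s) = {}"
    using nz s(2) by (fastforce simp: vec_eq_iff forall_3)+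
  moreover have "inj_on ?A (s \<times> s)" "inj_on ?B (s \<times> s)" "inj_on ?C (s \<times> s)"
    using nz by (auto simp: inj_on_def vec_eq_iff forall_3)
  ultimately have "sum f icosahedron =
      (\<Sum>z\<in>s \<times> s. f (?A z)) + (\<Sum>z\<in>s \<times> s. f (?B z)) + (\<Sum>z\<in>s \<times> s. f (?C z))"
    using s(1) by (simp add: icosahedron_eq_images sum.union_disjoint sum.reindex flip: s_def)
  then show ?thesis
    by (simp add: sum.cartesian_product sum.distrib case_prod_unfold flip: s_def)
qed

text \<open>A crude bound, valid since the 1-norm of a vertex is \<open>1 + golden_ratio\<close>.\<close>

lemma icosahedron_l1_norm:
  assumes "\<eta> \<in> icosahedron"
  shows "(\<Sum>i\<in>UNIV. \<bar>\<eta> $ i\<bar>) \<le> 3"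
  using assms golden_ratio_bounds unfolding icosahedron_def by (auto simp: sum_3 abs_mult)

lemma icosahedron_norm_le:
  assumes "\<eta> \<in> icosahedron"
  shows "norm \<eta> \<le> 3"
  using icosahedron_l1_norm[OF assms] norm_le_l1_cart[of \<eta>] by simp

text \<open>Antipodal vertices cancel.\<close>

lemma icosahedron_third_moment:
  "(\<Sum>\<eta>\<in>icosahedron. (p \<bullet> \<eta>) ^ 3) = 0"
  by (simp add: sum_icosahedron inner_vec_def sum_3) algebra

lemma icosahedron_second_moment:
  "(\<Sum>\<eta>\<in>icosahedron. (p \<bullet> \<eta>)\<^sup>2) = 4 * (1 + golden_ratio\<^sup>2) * (norm p)\<^sup>2"
  unfolding power2_norm_eq_inner
  by (simp add: sum_icosahedron inner_vec_def sum_3) algebra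

text \<open>Isotropy of the fourth moments. By symmetry under sign changes and cyclic permutations of the
  coordinates everything reduces to \<open>\<Sum>(\<eta> $ 1) ^ 4 = 3 \<Sum>(\<eta> $ 1)\<^sup>2 (\<eta> $ 2)\<^sup>2\<close>, that is
  \<open>1 + \<tau> ^ 4 = 3 \<tau>\<^sup>2\<close>, which follows from \<open>\<tau>\<^sup>2 = \<tau> + 1\<close> for the golden ratio \<open>\<tau>\<close>.\<close>

lemma icosahedron_fourth_moment:
  "(\<Sum>\<eta>\<in>icosahedron. (p \<bullet> \<eta>)\<^sup>2 * \<eta> $ i * \<eta> $ j) =
     4 * golden_ratio\<^sup>2 * ((if i = j then (norm p)\<^sup>2 else 0) + 2 * p $ i * p $ j)"
proof -
  have quartic: "golden_ratio ^ 4 = 3 * golden_ratio\<^sup>2 - 1"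
    using golden_ratio_square by algebra
  have sq: "(norm p)\<^sup>2 = (p $ 1)\<^sup>2 + (p $ 2)\<^sup>2 + (p $ 3)\<^sup>2"
    unfolding power2_norm_eq_inner by (simp add: inner_vec_def sum_3 power2_eq_square)
  have "\<forall>i j. (\<Sum>\<eta>\<in>icosahedron. (p \<bullet> \<eta>)\<^sup>2 * \<eta> $ i * \<eta> $ j) =
     4 * golden_ratio\<^sup>2 * ((if i = j then (norm p)\<^sup>2 else 0) + 2 * p $ i * p $ j)"
    unfolding forall_3
    by (intro conjI; simp add: sq sum_icosahedron inner_vec_def sum_3; algebra add: quartic)
  then show ?thesis by blast
qed

lemma icosahedron_fourth_moment_form:
  fixes H :: "3 \<Rightarrow> 3 \<Rightarrow> real"
  shows "(\<Sum>\<eta>\<in>icosahedron. (p \<bullet> \<eta>)\<^sup>2 * (\<Sum>i\<in>UNIV. \<Sum>j\<in>UNIV. \<eta> $ i * \<eta> $ j * H i j)) =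
    4 * golden_ratio\<^sup>2 * ((norm p)\<^sup>2 * (\<Sum>i\<in>UNIV. H i i) +
       2 * (\<Sum>i\<in>UNIV. \<Sum>j\<in>UNIV. p $ i * p $ j * H i j))"
proof -
  have "(\<Sum>\<eta>\<in>icosahedron. (p \<bullet> \<eta>)\<^sup>2 * (\<Sum>i\<in>UNIV. \<Sum>j\<in>UNIV. \<eta> $ i * \<eta> $ j * H i j)) =
      (\<Sum>i\<in>UNIV. \<Sum>j\<in>UNIV. \<Sum>\<eta>\<in>icosahedron. (p \<bullet> \<eta>)\<^sup>2 * \<eta> $ i * \<eta> $ j * H i j)"
    unfolding sum_distrib_left
    by (subst sum.swap, rule sum.cong[OF refl], subst sum.swap) (simp add: mult.assoc)
  also have "\<dots> = (\<Sum>i\<in>UNIV. \<Sum>j\<in>UNIV. 4 * golden_ratio\<^sup>2 *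
      ((if i = j then (norm p)\<^sup>2 else 0) + 2 * p $ i * p $ j) * H i j)"
    unfolding icosahedron_fourth_moment[symmetric] sum_distrib_right ..
  finally show ?thesis
    by (simp add: sum_3 algebra_simps)
qed

section \<open>The asymptotic mean value property\<close>

lemma bounded_partials_up_to:
  assumes "f \<in> Cb_infinity U"
  obtains B where "1 \<le> B"
    "\<And>is x. length is \<le> n \<Longrightarrow> x \<in> U \<Longrightarrow> \<bar>iterated_partial is f x\<bar> \<le> B"
proof -
  have "finite {is :: 'a list. length is \<le> n}"
    using finite_lists_length_le[of "UNIV :: 'a set" n] by simp
  moreover have "bounded (iterated_partial is f ` U)" for "is"
    using assms by (simp add: Cb_infinity_def)
  ultimately have "bounded (\<Union>is\<in>{is. length is \<le> n}. iterated_partial is f ` U)"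
    by (intro bounded_UN) auto
  then obtain B where "\<forall>y\<in>(\<Union>is\<in>{is. length is \<le> n}. iterated_partial is f ` U). \<bar>y\<bar> \<le> B"
    by (auto simp: bounded_iff)
  then show thesis
    by (intro that[of "max 1 B"]) (auto simp: le_max_iff_disj)
qed

lemma continuous_on_grad:
  assumes "f \<in> Cb_infinity U"
  shows "continuous_on U (grad f)"
proof -
  have "continuous_on U (iterated_partial [i] f)" for i
    using assms unfolding Cb_infinity_def
    by (intro continuous_at_imp_continuous_on ballI differentiable_imp_continuous_within) blast
  then show ?thesis
    unfolding grad_def by (intro continuous_on_vec_lambda) simp
qed

text \<open>The gradient is continuous on \<open>U\<close>, so its norm attains a minimum on the compact closure of \<open>S\<close>.\<close>

lemma grad_bounded_below:
  fixes f :: "real ^ 'n::finite \<Rightarrow> real"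
  assumes "f \<in> Cb_infinity U" "\<forall>x\<in>U. grad f x \<noteq> 0" "bounded S" "closure S \<subseteq> U"
  obtains g where "0 < g" "\<And>x. x \<in> S \<Longrightarrow> g \<le> norm (grad f x)"
proof (cases "S = {}")
  case False
  have "continuous_on (closure S) (\<lambda>x. norm (grad f x))"
    using continuous_on_subset[OF continuous_on_grad[OF assms(1)] assms(4)]
    by (rule continuous_on_norm)
  then obtain x0 where "x0 \<in> closure S" "\<forall>x\<in>closure S. norm (grad f x0) \<le> norm (grad f x)"
    using continuous_attains_inf[of "closure S"] assms(3) False by auto
  then show thesis
    using that[of "norm (grad f x0)"] assms(2,4) closure_subset[of S] by auto
qed (use that[of 1] in auto)

text \<open>The pointwise expansion with an explicit threshold for \<open>\<epsilon>\<close>. The segments from \<open>x\<close> to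
  \<open>x + \<epsilon> \<eta>\<close> must stay inside \<open>U\<close>, and vertices have norm at most 3. The bound \<open>9 B\<close> dominates
  the three Taylor coefficients, which are at most \<open>3 B\<close>, \<open>9 B / 2\<close> and \<open>27 B / 6\<close>; the weights
  satisfy \<open>\<Sum>v\<^sup>2 \<ge> 4 g\<^sup>2\<close>.\<close>

lemma four_average_expansion:
  fixes \<phi> :: "real ^ 3 \<Rightarrow> real"
  assumes smooth: "\<phi> \<in> Cb_infinity U"
    and g: "0 < g" "g \<le> norm (grad \<phi> x)"
    and B: "1 \<le> B" "\<And>is y. length is \<le> 3 \<Longrightarrow> y \<in> U \<Longrightarrow> \<bar>iterated_partial is \<phi> y\<bar> \<le> B"
    and \<kappa>: "0 < \<kappa>" "\<kappa> \<le> 1"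
    and \<epsilon>: "0 < \<epsilon>" "\<epsilon> \<le> 1" "115 * real (card icosahedron) * (9 * B) ^ 3 * \<epsilon> < 3 * \<kappa> * (4 * g\<^sup>2)"
    and nbhd: "cball x (3 * \<epsilon>) \<subseteq> U"
  shows "\<bar>four_average \<epsilon> \<phi> x - (\<phi> x + \<epsilon>\<^sup>2 *
           (2 * golden_ratio\<^sup>2 / (1 + golden_ratio\<^sup>2) * game_p_laplacian 4 \<phi> x))\<bar> \<le> \<kappa> * \<epsilon>\<^sup>2"
proof -
  let ?p = "grad \<phi> x"
  define H where "H = (\<lambda>i j. iterated_partial [i, j] \<phi> x)"
  define v where "v = (\<lambda>\<eta>. ?p \<bullet> \<eta>)"
  define w where "w = (\<lambda>\<eta>. directional_deriv \<eta> 2 \<phi> x / 2)"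
  have "x \<in> U" using nbhd \<epsilon> by auto
  have diff: "iterated_partial is \<phi> differentiable at y" if "y \<in> U" for "is" y
    using smooth that by (simp add: Cb_infinity_def)
  have pdiff: "partial_deriv i \<phi> differentiable at x" for i
    using diff[OF \<open>x \<in> U\<close>, of "[i]"] by simp
  have nz: "?p \<noteq> 0" using g by auto
  have line: "x + t *\<^sub>R \<eta> \<in> U" if "\<eta> \<in> icosahedron" "0 \<le> t" "t \<le> \<epsilon>" for t \<eta>
  proof -
    have "t * norm \<eta> \<le> \<epsilon> * 3"
      using that icosahedron_norm_le[OF that(1)] \<epsilon> by (intro mult_mono) auto
    then show ?thesis using nbhd that by (auto simp: dist_norm subset_iff)
  qed
  have deriv_bound: "\<bar>directional_deriv \<eta> k \<phi> y\<bar> \<le> 3 ^ k * B"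
    if "\<eta> \<in> icosahedron" "y \<in> U" "k \<le> 3" for \<eta> k y
  proof -
    have "\<bar>directional_deriv \<eta> k \<phi> y\<bar> \<le> (\<Sum>i\<in>UNIV. \<bar>\<eta> $ i\<bar>) ^ k * B"
      using that B(2) by (intro abs_directional_deriv_le) auto
    also have "\<dots> \<le> 3 ^ k * B"
      using icosahedron_l1_norm[OF that(1)] B(1) by (intro mult_right_mono power_mono) (auto intro: sum_nonneg)
    finally show ?thesis .
  qed
  have "\<exists>r. \<bar>r\<bar> \<le> 9 * B \<and> \<phi> (x + \<epsilon> *\<^sub>R \<eta>) = \<phi> x + \<epsilon> * v \<eta> + \<epsilon>\<^sup>2 * w \<eta> + \<epsilon> ^ 3 * r"
    if \<eta>: "\<eta> \<in> icosahedron" for \<eta>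
  proof -
    obtain t where t: "0 < t" "t < \<epsilon>" and eq: "\<phi> (x + \<epsilon> *\<^sub>R \<eta>) =
        (\<Sum>k<3. directional_deriv \<eta> k \<phi> x / fact k * \<epsilon> ^ k)
          + directional_deriv \<eta> 3 \<phi> (x + t *\<^sub>R \<eta>) / fact 3 * \<epsilon> ^ 3"
      using taylor_along_line[of \<epsilon> 3 \<phi> x \<eta>] \<epsilon> diff line[OF \<eta>] by auto
    have "\<bar>directional_deriv \<eta> 3 \<phi> (x + t *\<^sub>R \<eta>)\<bar> \<le> 27 * B"
      using deriv_bound[OF \<eta> line[OF \<eta>], of t 3] t by simp
    then have "\<bar>directional_deriv \<eta> 3 \<phi> (x + t *\<^sub>R \<eta>) / fact 3\<bar> \<le> 9 * B"
      using B(1) by (simp add: fact_numeral)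
    moreover have "(\<Sum>k<3. directional_deriv \<eta> k \<phi> x / fact k * \<epsilon> ^ k) = \<phi> x + \<epsilon> * v \<eta> + \<epsilon>\<^sup>2 * w \<eta>"
      unfolding v_def w_def
      by (simp add: eval_nat_numeral directional_deriv_1)
    ultimately show ?thesis
      by (intro exI[of _ "directional_deriv \<eta> 3 \<phi> (x + t *\<^sub>R \<eta>) / fact 3"] conjI)
        (simp_all only: eq mult.commute[of "\<epsilon> ^ 3"])
  qed
  then have "\<forall>\<eta>\<in>icosahedron. \<exists>r. \<bar>r\<bar> \<le> 9 * B \<and>
      \<phi> (x + \<epsilon> *\<^sub>R \<eta>) = \<phi> x + \<epsilon> * v \<eta> + \<epsilon>\<^sup>2 * w \<eta> + \<epsilon> ^ 3 * r"
    by blast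
  from bchoice[OF this] obtain r where r: "\<And>\<eta>. \<eta> \<in> icosahedron \<Longrightarrow> \<bar>r \<eta>\<bar> \<le> 9 * B"
    "\<And>\<eta>. \<eta> \<in> icosahedron \<Longrightarrow> \<phi> (x + \<epsilon> *\<^sub>R \<eta>) = \<phi> x + \<epsilon> * v \<eta> + \<epsilon>\<^sup>2 * w \<eta> + \<epsilon> ^ 3 * r \<eta>"
    by blast
  have vB: "\<bar>v \<eta>\<bar> \<le> 9 * B" and wB: "\<bar>w \<eta>\<bar> \<le> 9 * B" if "\<eta> \<in> icosahedron" for \<eta>
    using deriv_bound[OF that \<open>x \<in> U\<close>, of 1] deriv_bound[OF that \<open>x \<in> U\<close>, of 2] B(1)
    by (auto simp: v_def w_def directional_deriv_1)
  have v2: "(\<Sum>\<eta>\<in>icosahedron. (v \<eta>)\<^sup>2) = 4 * (1 + golden_ratio\<^sup>2) * (norm ?p)\<^sup>2"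
    unfolding v_def by (rule icosahedron_second_moment)
  have q: "4 * g\<^sup>2 \<le> (\<Sum>\<eta>\<in>icosahedron. (v \<eta>)\<^sup>2)"
  proof -
    have "g\<^sup>2 \<le> (norm ?p)\<^sup>2" using g by (intro power_mono) auto
    also have "\<dots> \<le> (1 + golden_ratio\<^sup>2) * (norm ?p)\<^sup>2"
      by (simp add: distrib_right)
    finally show ?thesis unfolding v2 by linarith
  qed
  have cancel: "8 * s * N * L / (4 * t * N) = 2 * s / t * L" if "N \<noteq> 0" "t \<noteq> 0" for s t N L :: real
    using that by (simp add: divide_simps)
  \<comment> \<open>Identification of the weighted mean of \<open>w\<close>: the factor \<open>4 golden_ratio\<^sup>2 / 2\<close> from the fourth
    moments, times 4 from the game Laplacian, over \<open>4 (1 + golden_ratio\<^sup>2)\<close> from the second.\<close>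
  have "(\<Sum>\<eta>\<in>icosahedron. (v \<eta>)\<^sup>2 * w \<eta>) =
      2 * golden_ratio\<^sup>2 * ((norm ?p)\<^sup>2 * (\<Sum>i\<in>UNIV. H i i) +
        2 * (\<Sum>i\<in>UNIV. \<Sum>j\<in>UNIV. ?p $ i * ?p $ j * H i j))"
    using icosahedron_fourth_moment_form[of ?p H]
    unfolding v_def w_def directional_deriv_2 H_def
    by (simp del: iterated_partial.simps flip: sum_divide_distrib)
  also have "\<dots> = 8 * golden_ratio\<^sup>2 * (norm ?p)\<^sup>2 * game_p_laplacian 4 \<phi> x"
    using nz pdiff by (subst game_4_laplacian_eq) (auto simp: H_def field_simps simp del: iterated_partial.simps(2))
  finally have "(\<Sum>\<eta>\<in>icosahedron. (v \<eta>)\<^sup>2 * w \<eta>) / (\<Sum>\<eta>\<in>icosahedron. (v \<eta>)\<^sup>2)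
      = 2 * golden_ratio\<^sup>2 / (1 + golden_ratio\<^sup>2) * game_p_laplacian 4 \<phi> x"
    unfolding v2 using nz cancel[of "(norm ?p)\<^sup>2" "1 + golden_ratio\<^sup>2"]
    by (simp add: add_nonneg_eq_0_iff)
  moreover have "(\<Sum>\<eta>\<in>icosahedron. v \<eta> ^ 3) = 0"
    unfolding v_def by (rule icosahedron_third_moment)
  ultimately show ?thesis
    using quartic_mean_expansion[OF finite_icosahedron _ _ q _ vB wB r(1) \<kappa> \<epsilon> r(2)] g B(1)
    by (simp add: four_average_def)
qed

theorem theorem3p5:
  "\<exists>c::real. \<forall>(\<Omega> :: (real ^ 3) set) (\<phi> :: real ^ 3 \<Rightarrow> real).
     open \<Omega> \<longrightarrow> connected \<Omega> \<longrightarrow> \<Omega> \<noteq> {} \<longrightarrow> bounded \<Omega> \<longrightarrow>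
     \<phi> \<in> Cb_infinity (unit_enlargement \<Omega>) \<longrightarrow>
     (\<forall>x\<in>unit_enlargement \<Omega>. grad \<phi> x \<noteq> 0) \<longrightarrow>
     uniform_limit \<Omega>
       (\<lambda>\<epsilon> x. (\<phi> x - (four_average \<epsilon> \<phi> x + c * \<epsilon>\<^sup>2 * (- game_p_laplacian 4 \<phi> x))) / \<epsilon>\<^sup>2)
       (\<lambda>x. 0) (at_right 0)"
proof (intro exI allI impI)
  fix \<Omega> :: "(real ^ 3) set" and \<phi> :: "real ^ 3 \<Rightarrow> real"
  let ?U = "unit_enlargement \<Omega>"
  let ?c = "2 * golden_ratio\<^sup>2 / (1 + golden_ratio\<^sup>2)"
  assume \<Omega>: "\<Omega> \<noteq> {}" "bounded \<Omega>" and smooth: "\<phi> \<in> Cb_infinity ?U"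
    and nz: "\<forall>x\<in>?U. grad \<phi> x \<noteq> 0"
  have "closure \<Omega> \<subseteq> ?U"
    by (auto simp: unit_enlargement_def in_closure_iff_infdist_zero[OF \<Omega>(1)])
  then obtain g where g: "0 < g" "\<And>x. x \<in> \<Omega> \<Longrightarrow> g \<le> norm (grad \<phi> x)"
    using grad_bounded_below[OF smooth nz \<Omega>(2)] by blast
  obtain B where B: "1 \<le> B"
    "\<And>is x. length is \<le> 3 \<Longrightarrow> x \<in> ?U \<Longrightarrow> \<bar>iterated_partial is \<phi> x\<bar> \<le> B"
    using bounded_partials_up_to[OF smooth, of 3] by blast
  show "uniform_limit \<Omega>
      (\<lambda>\<epsilon> x. (\<phi> x - (four_average \<epsilon> \<phi> x + ?c * \<epsilon>\<^sup>2 * (- game_p_laplacian 4 \<phi> x))) / \<epsilon>\<^sup>2)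
      (\<lambda>x. 0) (at_right 0)"
  proof (rule uniform_limitI)
    fix e :: real assume "0 < e"
    define \<kappa> where "\<kappa> = min 1 (e / 2)"
    have \<kappa>: "0 < \<kappa>" "\<kappa> \<le> 1" "\<kappa> < e" using \<open>0 < e\<close> by (auto simp: \<kappa>_def)
    let ?C = "115 * real (card icosahedron) * (9 * B) ^ 3"
    have "((\<lambda>\<epsilon>. ?C * \<epsilon>) \<longlongrightarrow> ?C * 0) (at_right 0)"
      by (intro tendsto_intros)
    then have "\<forall>\<^sub>F \<epsilon> in at_right 0. ?C * \<epsilon> < 3 * \<kappa> * (4 * g\<^sup>2)"
      using \<kappa> g by (intro order_tendstoD) auto
    \<comment> \<open>Below \<open>1 / 3\<close> the balls of radius \<open>3 \<epsilon>\<close> stay inside the unit enlargement.\<close>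
    moreover have "\<forall>\<^sub>F \<epsilon> :: real in at_right 0. 0 < \<epsilon> \<and> \<epsilon> < 1 / 3"
      using eventually_at_right_real[of 0 "1 / 3"] by simp
    ultimately show "\<forall>\<^sub>F \<epsilon> in at_right 0. \<forall>x\<in>\<Omega>. dist ((\<phi> x - (four_average \<epsilon> \<phi> x
        + ?c * \<epsilon>\<^sup>2 * (- game_p_laplacian 4 \<phi> x))) / \<epsilon>\<^sup>2) 0 < e"
    proof eventually_elim
      case (elim \<epsilon>)
      show ?case
      proof
        fix x assume "x \<in> \<Omega>"
        have "cball x (3 * \<epsilon>) \<subseteq> ?U"
        proof
          fix y assume "y \<in> cball x (3 * \<epsilon>)"
          then have "infdist y \<Omega> \<le> 3 * \<epsilon>"
            using infdist_le2[OF \<open>x \<in> \<Omega>\<close>, of y] by (simp add: dist_commute)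
          then show "y \<in> ?U" using elim by (simp add: unit_enlargement_def)
        qed
        then have "\<bar>four_average \<epsilon> \<phi> x - (\<phi> x + \<epsilon>\<^sup>2 * (?c * game_p_laplacian 4 \<phi> x))\<bar> \<le> \<kappa> * \<epsilon>\<^sup>2"
          using elim \<kappa> by (intro four_average_expansion[OF smooth g(1) g(2)[OF \<open>x \<in> \<Omega>\<close>] B]) auto
        also have "\<dots> < e * \<epsilon>\<^sup>2" using \<kappa> elim by simp
        finally have "\<bar>\<phi> x - (four_average \<epsilon> \<phi> x + ?c * \<epsilon>\<^sup>2 * (- game_p_laplacian 4 \<phi> x))\<bar> < e * \<epsilon>\<^sup>2"
          by (subst abs_minus_commute) (simp add: algebra_simps)
        then show "dist ((\<phi> x - (four_average \<epsilon> \<phi> x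
            + ?c * \<epsilon>\<^sup>2 * (- game_p_laplacian 4 \<phi> x))) / \<epsilon>\<^sup>2) 0 < e"
          using elim by (simp add: dist_norm pos_divide_less_eq)
      qed
    qed
  qed
qed

end
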